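(* Let $q$ be a prime number. Every (finite, undirected, simple) $q$-multigraph $G=(V,\Gamma)$ has an MLS cover; that is, every vertex $u\in V$ is contained in at least one minimal local set of $G$.
   Context: For a prime $q$, a $q$-multigraph is a pair $G=(V,\Gamma)$ where $V$ is a finite set of vertices and $\Gamma:V\times V\to\mathbb F_q$; it is undirected and simple if $\Gamma(u,v)=\Gamma(v,u)$ and $\Gamma(u,u)=0$ for all $u,v\in V$. Its cut-rank function $\mathrm{cutrk}:2^V\to\mathbb N$ maps $A\subseteq V$ to the rank over $\mathbb F_q$ of the matrix $\Gamma_A$ with rows indexed by $A$, columns indexed by $V\setminus A$, and entries $(\Gamma_A)_{ab}=\Gamma(a,b)$ (the rank of an empty matrix is $0$). A set $A\subseteq V$ is full cut-rank if $\mathrm{cutrk}(A)=|A|$. A minimal local set of $G$ is a set $A\subseteq V$ that is not full cut-rank but all of whose proper subsets are full cut-rank. A family $\mathcal L\subseteq 2^V$ is an MLS cover of $G$ if every $L\in\mathcal L$ is a minimal local set of $G$ and every $u\in V$ belongs to some $L\in\mathcal L$. *)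

theory Defs
  imports
    "HOL-Library.Countable_Set"
    "Berlekamp_Zassenhaus.Finite_Field"
    "Jordan_Normal_Form.DL_Rank"
begin

(* The prime field F_q is the type 'q mod_ring, where 'q :: prime_card and q = CARD('q).
   Only the values of \<Gamma> on V \<times> V matter below. *)

definition undirected_simple_multigraph ::
    "'v set \<Rightarrow> ('v \<Rightarrow> 'v \<Rightarrow> 'q::prime_card mod_ring) \<Rightarrow> bool" where
  "undirected_simple_multigraph V \<Gamma> \<longleftrightarrow>
     finite V \<and> (\<forall>u\<in>V. \<forall>v\<in>V. \<Gamma> u v = \<Gamma> v u) \<and> (\<forall>u\<in>V. \<Gamma> u u = 0)"

(* Matrices of type mat are indexed by initial segments of the naturals. For finite S,
   from_nat_into S is a bijection from {..<card S} to S; since rank is invariant under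
   permuting rows and columns, the choice of enumeration does not affect cutrk. *)
definition cut_matrix ::
    "'v set \<Rightarrow> ('v \<Rightarrow> 'v \<Rightarrow> 'q::prime_card mod_ring) \<Rightarrow> 'v set \<Rightarrow> 'q mod_ring mat" where
  "cut_matrix V \<Gamma> A =
     mat (card A) (card (V - A))
       (\<lambda>(i, j). \<Gamma> (from_nat_into A i) (from_nat_into (V - A) j))"

(* The first argument of vec_space.rank is the number of rows. *)
definition cutrk ::
    "'v set \<Rightarrow> ('v \<Rightarrow> 'v \<Rightarrow> 'q::prime_card mod_ring) \<Rightarrow> 'v set \<Rightarrow> nat" where
  "cutrk V \<Gamma> A = vec_space.rank (card A) (cut_matrix V \<Gamma> A)"

definition full_cut_rank ::
    "'v set \<Rightarrow> ('v \<Rightarrow> 'v \<Rightarrow> 'q::prime_card mod_ring) \<Rightarrow> 'v set \<Rightarrow> bool" where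
  "full_cut_rank V \<Gamma> A \<longleftrightarrow> A \<subseteq> V \<and> cutrk V \<Gamma> A = card A"

definition minimal_local_set ::
    "'v set \<Rightarrow> ('v \<Rightarrow> 'v \<Rightarrow> 'q::prime_card mod_ring) \<Rightarrow> 'v set \<Rightarrow> bool" where
  "minimal_local_set V \<Gamma> A \<longleftrightarrow>
     A \<subseteq> V \<and> \<not> full_cut_rank V \<Gamma> A \<and> (\<forall>B. B \<subset> A \<longrightarrow> full_cut_rank V \<Gamma> B)"

definition MLS_cover ::
    "'v set \<Rightarrow> ('v \<Rightarrow> 'v \<Rightarrow> 'q::prime_card mod_ring) \<Rightarrow> 'v set set \<Rightarrow> bool" where
  "MLS_cover V \<Gamma> \<L> \<longleftrightarrow>
     (\<forall>L\<in>\<L>. minimal_local_set V \<Gamma> L) \<and> (\<forall>u\<in>V. \<exists>L\<in>\<L>. u \<in> L)"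

end

theory Submission
  imports Defs
begin

text \<open>
  Identify a vector x with the word (x, \<Gamma>x) over pairs of field elements, one pair per vertex. A set is
  full cut-rank iff it supports no nonzero word, and symmetry of \<Gamma> makes any two words orthogonal for
  the symplectic form summed over V. Suppose that u lies in no minimal local set. Then deleting u
  from a set that is not full cut-rank keeps it so; hence a maximal full cut-rank set A contains u, and for each
  v outside A some word w supported in (A - {u}) \<union> {v} is nonzero at v. As A is full cut-rank, there are words
  z, z' supported in (V - A) \<union> {u} whose symplectic product at u is nonzero. Each meets w at v only,
  so at v both are multiples of w and have symplectic product 0 there. The total
  symplectic product of z and z' is thus nonzero, a contradiction.
\<close>

section \<open>Linear systems indexed by finite sets\<close>

text \<open>Induction on the rows: a solution for the old rows is corrected by a multiple of a
  vector that all old rows annihilate and the new row \<open>r\<close> does not. Independence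
  supplies that vector.\<close>

lemma independent_rows_imp_solvable:
  fixes M :: "'a \<Rightarrow> 'b \<Rightarrow> 'f::field"
  assumes "finite A" "finite B"
    and "\<And>x. (\<forall>b\<in>B. (\<Sum>a\<in>A. M a b * x a) = 0) \<Longrightarrow> \<forall>a\<in>A. x a = 0"
  shows "\<exists>y. \<forall>a\<in>A. (\<Sum>b\<in>B. M a b * y b) = t a"
  using assms(1,3)
proof (induction A arbitrary: t rule: finite_induct)
  case empty
  show ?case by simp
next
  case (insert r A)
  have solvable: "\<exists>y. \<forall>a\<in>A. (\<Sum>b\<in>B. M a b * y b) = s a" for s
  proof (rule insert.IH)
    fix x assume x: "\<forall>b\<in>B. (\<Sum>a\<in>A. M a b * x a) = 0"
    \<comment> \<open>A relation among the old rows extends to the new row with coefficient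
      0.\<close>
    have "(\<Sum>a\<in>A. M a b * (x(r := 0)) a) = (\<Sum>a\<in>A. M a b * x a)" for b
      using insert.hyps by (intro sum.cong) auto
    with x have "\<forall>b\<in>B. (\<Sum>a\<in>insert r A. M a b * (x(r := 0)) a) = 0"
      using insert.hyps by simp
    from insert.prems[OF this] show "\<forall>a\<in>A. x a = 0"
      using insert.hyps by (metis fun_upd_other insertI2)
  qed
  have "\<exists>y. \<forall>a\<in>A. (\<Sum>b\<in>B. M a b * y b) = (if a = a' then 1 else 0)" for a'
    using solvable by simp
  then obtain Y where Y: "\<And>a a'. a \<in> A \<Longrightarrow> (\<Sum>b\<in>B. M a b * Y a' b) = (if a = a' then 1 else 0)"
    by metis
  \<comment> \<open>These coefficients subtract from row \<open>r\<close> the combination of the old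
    rows that agrees with it on every \<open>Y a\<close>. The coefficient 1 at \<open>r\<close>
    rules out a relation, so some column \<open>c\<close> is nonzero.\<close>
  define x where "x = (\<lambda>a. if a = r then 1 else - (\<Sum>b\<in>B. M r b * Y a b))"
  have "\<not> (\<forall>a\<in>insert r A. x a = 0)" by (simp add: x_def)
  with insert.prems obtain c where c: "c \<in> B" "(\<Sum>a\<in>insert r A. M a c * x a) \<noteq> 0" by blast
  \<comment> \<open>The unit vector at \<open>c\<close>, made orthogonal to the old rows with the
    help of the dual vectors \<open>Y a\<close>. Row \<open>r\<close> evaluated at \<open>k\<close>
    is entry \<open>c\<close> of the combination given by \<open>x\<close>, hence nonzero.\<close>
  define k where "k = (\<lambda>b. (if b = c then 1 else 0) - (\<Sum>a\<in>A. M a c * Y a b))"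
  have Mk: "(\<Sum>b\<in>B. M a b * k b) = M a c - (\<Sum>a'\<in>A. M a' c * (\<Sum>b\<in>B. M a b * Y a' b))" for a
  proof -
    have "(\<Sum>b\<in>B. M a b * k b)
        = (\<Sum>b\<in>B. M a b * (if b = c then 1 else 0)) - (\<Sum>b\<in>B. \<Sum>a'\<in>A. M a b * (M a' c * Y a' b))"
      by (simp add: k_def right_diff_distrib sum_subtractf sum_distrib_left)
    also have "(\<Sum>b\<in>B. M a b * (if b = c then 1 else 0)) = (\<Sum>b\<in>B. if b = c then M a b else 0)"
      by (intro sum.cong) auto
    also have "\<dots> = M a c"
      using assms(2) c(1) by simp
    also have "(\<Sum>b\<in>B. \<Sum>a'\<in>A. M a b * (M a' c * Y a' b))
        = (\<Sum>a'\<in>A. M a' c * (\<Sum>b\<in>B. M a b * Y a' b))"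
      by (subst sum.swap) (simp add: sum_distrib_left mult.left_commute)
    finally show ?thesis .
  qed
  have k0: "(\<Sum>b\<in>B. M a b * k b) = 0" if "a \<in> A" for a
  proof -
    have "(\<Sum>a'\<in>A. M a' c * (\<Sum>b\<in>B. M a b * Y a' b)) = (\<Sum>a'\<in>A. if a = a' then M a' c else 0)"
      using that by (intro sum.cong) (auto simp: Y)
    then show ?thesis using that insert.hyps by (simp add: Mk)
  qed
  have "(\<Sum>a\<in>A. M a c * x a) = - (\<Sum>a\<in>A. M a c * (\<Sum>b\<in>B. M r b * Y a b))"
    using insert.hyps unfolding sum_negf[symmetric] by (intro sum.cong) (auto simp: x_def)
  with c(2) have kr: "(\<Sum>b\<in>B. M r b * k b) \<noteq> 0"
    using insert.hyps by (simp add: Mk x_def)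
  obtain y where y: "\<forall>a\<in>A. (\<Sum>b\<in>B. M a b * y b) = t a" using solvable by blast
  define d where "d = (t r - (\<Sum>b\<in>B. M r b * y b)) / (\<Sum>b\<in>B. M r b * k b)"
  have "(\<Sum>b\<in>B. M a b * (y b + d * k b)) = (\<Sum>b\<in>B. M a b * y b) + d * (\<Sum>b\<in>B. M a b * k b)" for a
    by (simp add: distrib_left sum.distrib sum_distrib_left mult.left_commute)
  then have "\<forall>a\<in>insert r A. (\<Sum>b\<in>B. M a b * (y b + d * k b)) = t a"
    using y k0 kr by (simp add: d_def)
  then show ?case by (rule exI[where x = "\<lambda>b. y b + d * k b"])
qed

text \<open>Pair \<open>x\<close> with a solution \<open>y\<close> for the unit target at
  \<open>r\<close>: summed by rows the result is \<open>x r\<close>, summed by columns it is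
  0.\<close>

lemma solvable_imp_independent_rows:
  fixes M :: "'a \<Rightarrow> 'b \<Rightarrow> 'f::field"
  assumes "finite A"
    and "\<And>t. \<exists>y. \<forall>a\<in>A. (\<Sum>b\<in>B. M a b * y b) = t a"
    and x: "\<forall>b\<in>B. (\<Sum>a\<in>A. M a b * x a) = 0"
    and "r \<in> A"
  shows "x r = 0"
proof -
  obtain y where y: "\<forall>a\<in>A. (\<Sum>b\<in>B. M a b * y b) = (if a = r then 1 else 0)"
    using assms(2)[of "\<lambda>a. if a = r then 1 else 0"] by auto
  have "x r = (\<Sum>a\<in>A. if a = r then x a else 0)" using assms by simp
  also have "\<dots> = (\<Sum>a\<in>A. x a * (\<Sum>b\<in>B. M a b * y b))"
    using y by (intro sum.cong) auto
  also have "\<dots> = (\<Sum>b\<in>B. y b * (\<Sum>a\<in>A. M a b * x a))"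
    by (simp add: sum_distrib_left, subst sum.swap) (simp add: ac_simps)
  also have "\<dots> = 0" using x by simp
  finally show ?thesis .
qed

section \<open>Full cut-rank as solvability\<close>

text \<open>Both sides say that the columns span the whole space. If the rank is \<open>n\<close>, a
  maximal independent set of columns has \<open>n\<close> elements and is therefore a basis.\<close>

lemma (in vec_space) rank_eq_n_iff:
  assumes "A \<in> carrier_mat n nc"
  shows "rank A = n \<longleftrightarrow> (\<forall>t\<in>carrier_vec n. \<exists>y\<in>carrier_vec nc. A *\<^sub>v y = t)"
proof -
  let ?S = "set (cols A)"
  have S: "?S \<subseteq> carrier_vec n" using cols_dim[of A] assms by auto
  have "rank A = n \<longleftrightarrow> span ?S = carrier_vec n"
  proof
    assume n: "rank A = n"
    have "lin_indpt {}" using finite_basis_exists subset_li_is_li by (auto simp: basis_def)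
    then obtain U where U: "maximal U (\<lambda>T. T \<subseteq> ?S \<and> lin_indpt T)"
      using maximal_exists_superset[of ?S "\<lambda>T. T \<subseteq> ?S \<and> lin_indpt T" "{}"] by auto
    then have US: "U \<subseteq> ?S" "lin_indpt U" by (auto simp: maximal_def)
    have "card U = n" using rank_card_indpt[OF assms U] n by simp
    then have "basis U"
      using US S finite_subset[OF US(1)] by (intro dim_li_is_basis) (auto simp: dim_is_n)
    then have "span U = carrier_vec n" by (simp add: basis_def)
    then show "span ?S = carrier_vec n"
      using span_is_monotone[OF US(1)] span_closed[OF S] by auto
  next
    assume span: "span ?S = carrier_vec n"
    have "vs (carrier_vec n) = V" by simp
    then show "rank A = n" using dim_is_n by (simp only: rank_def span)
  qed
  also have "\<dots> \<longleftrightarrow> (\<forall>t\<in>carrier_vec n. \<exists>y\<in>carrier_vec nc. A *\<^sub>v y = t)"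
    using col_space_eq[OF assms] assms unfolding col_space_def by auto
  finally show ?thesis .
qed

lemma sum_from_nat_into:
  assumes "finite S"
  shows "(\<Sum>i<card S. f (from_nat_into S i)) = sum f S"
  using sum.reindex_bij_betw[OF bij_betw_from_nat_into_finite[OF assms], of f] by simp

text \<open>Replaces matrix indices by vertices once and for all, so that later arguments never meet
  the enumerations in \<open>cut_matrix\<close>.\<close>

lemma full_cut_rank_iff_solvable:
  fixes \<Gamma> :: "'v \<Rightarrow> 'v \<Rightarrow> 'q::prime_card mod_ring"
  assumes "finite V" "A \<subseteq> V"
  shows "full_cut_rank V \<Gamma> A \<longleftrightarrow> (\<forall>t. \<exists>y. \<forall>a\<in>A. (\<Sum>b\<in>V - A. \<Gamma> a b * y b) = t a)"
proof -
  let ?n = "card A" and ?m = "card (V - A)"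
  let ?f = "from_nat_into A" and ?g = "from_nat_into (V - A)"
  have fin: "finite A" "finite (V - A)" using assms finite_subset by auto
  have f: "bij_betw ?f {..<?n} A" and g: "bij_betw ?g {..<?m} (V - A)"
    using fin by (auto intro: bij_betw_from_nat_into_finite)
  have mult: "cut_matrix V \<Gamma> A *\<^sub>v y = t \<longleftrightarrow> (\<forall>i<?n. (\<Sum>j<?m. \<Gamma> (?f i) (?g j) * y $ j) = t $ i)"
    if "y \<in> carrier_vec ?m" "t \<in> carrier_vec ?n" for y t
    using that by (auto simp: cut_matrix_def vec_eq_iff scalar_prod_def lessThan_atLeast0)
  have "full_cut_rank V \<Gamma> A \<longleftrightarrow>
      (\<forall>t\<in>carrier_vec ?n. \<exists>y\<in>carrier_vec ?m. cut_matrix V \<Gamma> A *\<^sub>v y = t)"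
    unfolding full_cut_rank_def cutrk_def using assms
    by (subst vec_space.rank_eq_n_iff[where nc = ?m]) (auto simp: cut_matrix_def)
  also have "\<dots> \<longleftrightarrow> (\<forall>t. \<exists>y. \<forall>a\<in>A. (\<Sum>b\<in>V - A. \<Gamma> a b * y b) = t a)"
  proof safe
    fix t
    assume *: "\<forall>t\<in>carrier_vec ?n. \<exists>y\<in>carrier_vec ?m. cut_matrix V \<Gamma> A *\<^sub>v y = t"
    from *[rule_format, of "vec ?n (\<lambda>i. t (?f i))"] obtain y where y: "y \<in> carrier_vec ?m"
      "cut_matrix V \<Gamma> A *\<^sub>v y = vec ?n (\<lambda>i. t (?f i))" by auto
    define z where "z = (\<lambda>b. y $ (inv_into {..<?m} ?g b))"
    have "(\<Sum>b\<in>V - A. \<Gamma> (?f i) b * z b) = t (?f i)" if "i < ?n" for i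
    proof -
      have "(\<Sum>b\<in>V - A. \<Gamma> (?f i) b * z b) = (\<Sum>j<?m. \<Gamma> (?f i) (?g j) * z (?g j))"
        using sum_from_nat_into[OF fin(2), of "\<lambda>b. \<Gamma> (?f i) b * z b"] by simp
      also have "\<dots> = (\<Sum>j<?m. \<Gamma> (?f i) (?g j) * y $ j)"
        using g by (intro sum.cong) (auto simp: z_def bij_betw_inv_into_left)
      also have "\<dots> = t (?f i)" using y(2) that by (subst (asm) mult[OF y(1)]) auto
      finally show ?thesis .
    qed
    then have "\<forall>a\<in>?f ` {..<?n}. (\<Sum>b\<in>V - A. \<Gamma> a b * z b) = t a" by blast
    then have "\<forall>a\<in>A. (\<Sum>b\<in>V - A. \<Gamma> a b * z b) = t a"
      unfolding bij_betw_imp_surj_on[OF f] .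
    then show "\<exists>y. \<forall>a\<in>A. (\<Sum>b\<in>V - A. \<Gamma> a b * y b) = t a" by blast
  next
    fix t :: "'q mod_ring vec"
    assume *: "\<forall>t. \<exists>y. \<forall>a\<in>A. (\<Sum>b\<in>V - A. \<Gamma> a b * y b) = t a" and t: "t \<in> carrier_vec ?n"
    from * obtain y where y: "\<forall>a\<in>A. (\<Sum>b\<in>V - A. \<Gamma> a b * y b) = t $ (inv_into {..<?n} ?f a)"
      using *[rule_format, of "\<lambda>a. t $ (inv_into {..<?n} ?f a)"] by blast
    have "(\<Sum>j<?m. \<Gamma> (?f i) (?g j) * y (?g j)) = t $ i" if "i < ?n" for i
    proof -
      have "?f i \<in> A" using f that by (auto dest: bij_betwE)
      then show ?thesis
        using that y f sum_from_nat_into[OF fin(2), of "\<lambda>b. \<Gamma> (?f i) b * y b"]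
        by (simp add: bij_betw_inv_into_left)
    qed
    then have "cut_matrix V \<Gamma> A *\<^sub>v vec ?m (\<lambda>j. y (?g j)) = t"
      using t by (subst mult) auto
    then show "\<exists>y\<in>carrier_vec ?m. cut_matrix V \<Gamma> A *\<^sub>v y = t" by (intro bexI[of _ "vec ?m (\<lambda>j. y (?g j))"]) auto
  qed
  finally show ?thesis .
qed

section \<open>Words and their supports\<close>

text \<open>The second coordinate at \<open>v\<close> of the word of \<open>x\<close>; the first is
  \<open>x v\<close>.\<close>

definition nbr_sum :: "'v set \<Rightarrow> ('v \<Rightarrow> 'v \<Rightarrow> 'f::field) \<Rightarrow> ('v \<Rightarrow> 'f) \<Rightarrow> 'v \<Rightarrow> 'f" where
  "nbr_sum V \<Gamma> x v = (\<Sum>u\<in>V. \<Gamma> v u * x u)"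

definition supported :: "'v set \<Rightarrow> ('v \<Rightarrow> 'v \<Rightarrow> 'f::field) \<Rightarrow> 'v set \<Rightarrow> ('v \<Rightarrow> 'f) \<Rightarrow> bool" where
  "supported V \<Gamma> A x \<longleftrightarrow> (\<forall>v\<in>V - A. x v = 0 \<and> nbr_sum V \<Gamma> x v = 0)"

lemma nbr_sum_restrict:
  assumes "finite V" "S \<subseteq> V" "\<And>v. v \<in> V - S \<Longrightarrow> x v = 0"
  shows "nbr_sum V \<Gamma> x v = (\<Sum>u\<in>S. \<Gamma> v u * x u)"
  unfolding nbr_sum_def using assms by (intro sum.mono_neutral_right) auto

text \<open>By symmetry of \<open>\<Gamma>\<close>, a word supported in \<open>A\<close> is a linear
  relation among the rows of the cut matrix, and independence of these rows is equivalent to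
  solvability.\<close>

lemma full_cut_rank_iff_supported:
  assumes G: "undirected_simple_multigraph V \<Gamma>" and A: "A \<subseteq> V"
  shows "full_cut_rank V \<Gamma> A \<longleftrightarrow> (\<forall>x. supported V \<Gamma> A x \<longrightarrow> (\<forall>v\<in>V. x v = 0))"
proof -
  have V: "finite V" and sym: "\<And>u v. u \<in> V \<Longrightarrow> v \<in> V \<Longrightarrow> \<Gamma> u v = \<Gamma> v u"
    using G by (auto simp: undirected_simple_multigraph_def)
  have fin: "finite A" "finite (V - A)" using V A finite_subset by auto
  have rows: "(\<Sum>u\<in>A. \<Gamma> v u * x u) = (\<Sum>a\<in>A. \<Gamma> a v * x a)" if "v \<in> V" for v x
    using that A sym by (intro sum.cong refl) (metis subsetD)
  show ?thesis
    unfolding full_cut_rank_iff_solvable[OF V A]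
  proof safe
    fix x v
    assume solv: "\<forall>t. \<exists>y. \<forall>a\<in>A. (\<Sum>b\<in>V - A. \<Gamma> a b * y b) = t a"
      and x: "supported V \<Gamma> A x" and v: "v \<in> V"
    have "\<forall>b\<in>V - A. (\<Sum>a\<in>A. \<Gamma> a b * x a) = 0"
      using x nbr_sum_restrict[OF V A, of x] rows by (auto simp: supported_def)
    with solv have "x a = 0" if "a \<in> A" for a
      by (intro solvable_imp_independent_rows[of A \<Gamma> "V - A" x a]) (use fin(1) that in simp_all)
    then show "x v = 0" using x v by (auto simp: supported_def)
  next
    fix t
    assume triv: "\<forall>x. supported V \<Gamma> A x \<longrightarrow> (\<forall>v\<in>V. x v = 0)"
    show "\<exists>y. \<forall>a\<in>A. (\<Sum>b\<in>V - A. \<Gamma> a b * y b) = t a"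
    proof (rule independent_rows_imp_solvable[OF fin])
      fix x assume x: "\<forall>b\<in>V - A. (\<Sum>a\<in>A. \<Gamma> a b * x a) = 0"
      \<comment> \<open>The relation says nothing about \<open>x\<close> outside \<open>A\<close>,
        so those values are reset to 0.\<close>
      define x' where "x' = (\<lambda>v. if v \<in> A then x v else 0)"
      have "nbr_sum V \<Gamma> x' v = (\<Sum>a\<in>A. \<Gamma> a v * x a)" if "v \<in> V" for v
        using nbr_sum_restrict[OF V A, of x' \<Gamma> v] rows[OF that, of x] by (simp add: x'_def)
      with x have "supported V \<Gamma> A x'" by (auto simp: supported_def x'_def)
      with triv have "\<forall>v\<in>V. x' v = 0" by blast
      with A show "\<forall>a\<in>A. x a = 0" by (metis subsetD x'_def)
    qed
  qed
qed

text \<open>Every word supported in \<open>B\<close> is also supported in \<open>A\<close>.\<close>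

lemma full_cut_rank_subset:
  assumes G: "undirected_simple_multigraph V \<Gamma>" and "full_cut_rank V \<Gamma> A" "B \<subseteq> A"
  shows "full_cut_rank V \<Gamma> B"
proof -
  have "A \<subseteq> V" "B \<subseteq> V" using assms by (auto simp: full_cut_rank_def)
  moreover have "supported V \<Gamma> A x" if "supported V \<Gamma> B x" for x
    using that assms(3) by (auto simp: supported_def)
  ultimately show ?thesis using assms(2) by (simp add: full_cut_rank_iff_supported[OF G])
qed

lemma ex_minimal_local_set:
  assumes "finite A" "A \<subseteq> V" "\<not> full_cut_rank V \<Gamma> A"
  shows "\<exists>L\<subseteq>A. minimal_local_set V \<Gamma> L"
  using assms
proof (induction A rule: finite_psubset_induct)
  case (psubset A)
  show ?case
  proof (cases "\<forall>B. B \<subset> A \<longrightarrow> full_cut_rank V \<Gamma> B")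
    case True
    then show ?thesis using psubset.prems by (auto simp: minimal_local_set_def)
  next
    case False
    then obtain B where "B \<subset> A" "\<not> full_cut_rank V \<Gamma> B" by blast
    then show ?thesis using psubset.IH[of B] psubset.prems by blast
  qed
qed

section \<open>The symplectic form on words\<close>

text \<open>Both halves are the bilinear form of the symmetric matrix \<open>\<Gamma>\<close> at
  \<open>x\<close> and \<open>z\<close>, summed in the two possible orders.\<close>

lemma symplectic_sum_zero:
  assumes "undirected_simple_multigraph V \<Gamma>"
  shows "(\<Sum>v\<in>V. x v * nbr_sum V \<Gamma> z v - nbr_sum V \<Gamma> x v * z v) = 0"
proof -
  have sym: "\<And>u v. u \<in> V \<Longrightarrow> v \<in> V \<Longrightarrow> \<Gamma> u v = \<Gamma> v u"
    using assms by (auto simp: undirected_simple_multigraph_def)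
  have "(\<Sum>v\<in>V. x v * nbr_sum V \<Gamma> z v) = (\<Sum>v\<in>V. \<Sum>u\<in>V. \<Gamma> v u * x v * z u)"
    by (simp add: nbr_sum_def sum_distrib_left ac_simps)
  also have "\<dots> = (\<Sum>u\<in>V. \<Sum>v\<in>V. \<Gamma> v u * x v * z u)" by (rule sum.swap)
  also have "\<dots> = (\<Sum>u\<in>V. \<Sum>v\<in>V. \<Gamma> u v * x v * z u)"
    using sym by (intro sum.cong) auto
  also have "\<dots> = (\<Sum>v\<in>V. nbr_sum V \<Gamma> x v * z v)"
    by (simp add: nbr_sum_def sum_distrib_right)
  finally show ?thesis by (simp add: sum_subtractf)
qed

text \<open>At every vertex other than \<open>v\<close> one of the two words vanishes, so the total,
  which is 0, consists of the term at \<open>v\<close> alone.\<close>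

lemma commute_at_single_overlap:
  assumes G: "undirected_simple_multigraph V \<Gamma>"
    and "supported V \<Gamma> S x" "supported V \<Gamma> T z" "S \<inter> T \<subseteq> {v}" "v \<in> V"
  shows "x v * nbr_sum V \<Gamma> z v = nbr_sum V \<Gamma> x v * z v"
proof -
  let ?w = "\<lambda>v. x v * nbr_sum V \<Gamma> z v - nbr_sum V \<Gamma> x v * z v"
  have "finite V" using G by (simp add: undirected_simple_multigraph_def)
  moreover have "?w u = 0" if "u \<in> V - {v}" for u
  proof -
    have "u \<in> V - S \<or> u \<in> V - T" using that assms(4) by blast
    then show ?thesis using assms(2,3) by (auto simp: supported_def)
  qed
  ultimately have "sum ?w V = ?w v"
    using assms(5) by (subst sum.remove[of V v]) auto
  then show ?thesis using symplectic_sum_zero[OF G, of x z] by simp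
qed

text \<open>In the symplectic plane the orthogonal complement of a nonzero vector
  \<open>(p, r)\<close> is the line it spans, so \<open>(a, b)\<close> and \<open>(c, d)\<close> lie
  on one line.\<close>

lemma commuting_with_nonzero_imp_commute:
  fixes a b c d p r :: "'f::field"
  assumes "p \<noteq> 0 \<or> r \<noteq> 0" "a * r = b * p" "c * r = d * p"
  shows "a * d = b * c"
proof -
  have "p * (a * d) = p * (b * c)"
    using assms(2,3) by (metis mult.assoc mult.commute)
  moreover have "r * (a * d) = r * (b * c)"
    using assms(2,3) by (metis mult.assoc mult.commute)
  ultimately show ?thesis using assms(1) by auto
qed

text \<open>Full cut-rank lets values outside \<open>A\<close> produce any prescribed neighbour sums
  on \<open>A\<close>. The two words are chosen to be (0, 1) and (1, 0) at \<open>u\<close> and to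
  vanish on the rest of \<open>A\<close>.\<close>

lemma non_commuting_at_vertex:
  assumes G: "undirected_simple_multigraph V \<Gamma>" and A: "full_cut_rank V \<Gamma> A" and u: "u \<in> A"
  obtains z z' where
    "supported V \<Gamma> (insert u (V - A)) z" "supported V \<Gamma> (insert u (V - A)) z'"
    "z u * nbr_sum V \<Gamma> z' u \<noteq> nbr_sum V \<Gamma> z u * z' u"
proof -
  have V: "finite V" and AV: "A \<subseteq> V" and uu: "\<Gamma> u u = 0"
    using G A u by (auto simp: undirected_simple_multigraph_def full_cut_rank_def)
  note solv = A[unfolded full_cut_rank_iff_solvable[OF V AV], rule_format]
  obtain y where y: "\<forall>a\<in>A. (\<Sum>b\<in>V - A. \<Gamma> a b * y b) = (if a = u then 1 else 0)"
    using solv[of "\<lambda>a. if a = u then 1 else 0"] by blast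
  \<comment> \<open>This target cancels the contribution of the value 1 that \<open>z'\<close> takes
    at \<open>u\<close>.\<close>
  obtain y' where y': "\<forall>a\<in>A. (\<Sum>b\<in>V - A. \<Gamma> a b * y' b) = - \<Gamma> a u"
    using solv[of "\<lambda>a. - \<Gamma> a u"] by blast
  define z where "z = (\<lambda>v. if v \<in> A then 0 else y v)"
  define z' where "z' = (\<lambda>v. if v = u then 1 else if v \<in> A then 0 else y' v)"
  have z: "nbr_sum V \<Gamma> z a = (if a = u then 1 else 0)" if "a \<in> A" for a
    using nbr_sum_restrict[OF V, of "V - A" z \<Gamma> a] y that by (simp add: z_def)
  have z': "nbr_sum V \<Gamma> z' a = 0" if "a \<in> A" for a
  proof -
    have "nbr_sum V \<Gamma> z' a = (\<Sum>v\<in>insert u (V - A). \<Gamma> a v * z' v)"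
      using u AV by (intro nbr_sum_restrict[OF V]) (auto simp: z'_def)
    also have "\<dots> = \<Gamma> a u + (\<Sum>v\<in>V - A. \<Gamma> a v * z' v)"
      using u V by (simp add: z'_def)
    also have "(\<Sum>v\<in>V - A. \<Gamma> a v * z' v) = (\<Sum>v\<in>V - A. \<Gamma> a v * y' v)"
      using u by (intro sum.cong) (auto simp: z'_def)
    finally show ?thesis using y' that by simp
  qed
  show thesis
  proof
    show "supported V \<Gamma> (insert u (V - A)) z" "supported V \<Gamma> (insert u (V - A)) z'"
      using z z' by (auto simp: supported_def z_def z'_def)
    show "z u * nbr_sum V \<Gamma> z' u \<noteq> nbr_sum V \<Gamma> z u * z' u"
      using z[OF u] z'[OF u] by (simp add: z'_def)
  qed
qed

section \<open>Minimal local sets through a given vertex\<close>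

lemma ex_minimal_local_set_containing:
  assumes G: "undirected_simple_multigraph V \<Gamma>" and u: "u \<in> V"
  shows "\<exists>L. minimal_local_set V \<Gamma> L \<and> u \<in> L"
proof (rule ccontr)
  assume none: "\<not> ?thesis"
  have V: "finite V" using G by (simp add: undirected_simple_multigraph_def)
  have remove: "\<not> full_cut_rank V \<Gamma> (C - {u})" if C: "C \<subseteq> V" "\<not> full_cut_rank V \<Gamma> C" for C
  proof -
    \<comment> \<open>By assumption \<open>L\<close> avoids \<open>u\<close>, so it survives the
      deletion of \<open>u\<close> from \<open>C\<close>.\<close>
    obtain L where "L \<subseteq> C" and L: "minimal_local_set V \<Gamma> L"
      using ex_minimal_local_set[OF finite_subset[OF C(1) V] C] by blast
    with none have "L \<subseteq> C - {u}" by blast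
    with L show ?thesis using full_cut_rank_subset[OF G] by (auto simp: minimal_local_set_def)
  qed
  have "full_cut_rank V \<Gamma> {}" by (simp add: full_cut_rank_iff_solvable[OF V])
  moreover have "finite (Collect (full_cut_rank V \<Gamma>))"
    by (rule finite_subset[of _ "Pow V"]) (auto simp: full_cut_rank_def V)
  ultimately obtain A where A: "full_cut_rank V \<Gamma> A"
    and max: "\<And>B. full_cut_rank V \<Gamma> B \<Longrightarrow> A \<subseteq> B \<Longrightarrow> A = B"
    using finite_has_maximal[of "Collect (full_cut_rank V \<Gamma>)"] by blast
  have AV: "A \<subseteq> V" using A by (simp add: full_cut_rank_def)
  have uA: "u \<in> A"
  proof (rule ccontr)
    assume "u \<notin> A"
    then have "\<not> full_cut_rank V \<Gamma> (insert u A)" using max by blast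
    from remove[OF _ this] show False using A AV u \<open>u \<notin> A\<close> by simp
  qed
  obtain z z' where
    z: "supported V \<Gamma> (insert u (V - A)) z" and z': "supported V \<Gamma> (insert u (V - A)) z'"
    and zz': "z u * nbr_sum V \<Gamma> z' u \<noteq> nbr_sum V \<Gamma> z u * z' u"
    using non_commuting_at_vertex[OF G A uA] .
  \<comment> \<open>The local symplectic product of \<open>z\<close> and \<open>z'\<close>. Once it
    vanishes away from \<open>u\<close>, the nonzero term at \<open>u\<close> contradicts the zero
    total.\<close>
  let ?w = "\<lambda>v. z v * nbr_sum V \<Gamma> z' v - nbr_sum V \<Gamma> z v * z' v"
  have "?w v = 0" if v: "v \<in> V" "v \<noteq> u" for v
  proof (cases "v \<in> A")
    case True
    then show ?thesis using z z' v by (simp add: supported_def)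
  next
    case False
    let ?B = "insert v (A - {u})"
    \<comment> \<open>Maximality of \<open>A\<close> makes this set fail, and deleting
      \<open>u\<close> preserves the failure; this yields a nonzero word on
      \<open>?B\<close>.\<close>
    have "\<not> full_cut_rank V \<Gamma> (insert v A)" using max False by blast
    from remove[OF _ this] have "\<not> full_cut_rank V \<Gamma> ?B"
      using AV v by (simp add: insert_Diff_if)
    then obtain w where w: "supported V \<Gamma> ?B w" and w0: "\<exists>v\<in>V. w v \<noteq> 0"
      using full_cut_rank_iff_supported[OF G, of ?B] AV v by auto
    \<comment> \<open>If \<open>w\<close> vanished at \<open>v\<close> in both coordinates, it would
      be a nonzero word supported in \<open>A\<close>.\<close>
    have "\<not> supported V \<Gamma> A w" using w0 A full_cut_rank_iff_supported[OF G AV] by blast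
    with w have "w v \<noteq> 0 \<or> nbr_sum V \<Gamma> w v \<noteq> 0" by (auto simp: supported_def)
    \<comment> \<open>The sets \<open>?B\<close> and \<open>insert u (V - A)\<close> meet only in
      \<open>v\<close>, because \<open>u\<close> was removed from \<open>?B\<close>.\<close>
    moreover have "z v * nbr_sum V \<Gamma> w v = nbr_sum V \<Gamma> z v * w v"
      "z' v * nbr_sum V \<Gamma> w v = nbr_sum V \<Gamma> z' v * w v"
      using z z' w v by (auto intro!: commute_at_single_overlap[OF G])
    ultimately have "z v * nbr_sum V \<Gamma> z' v = nbr_sum V \<Gamma> z v * z' v"
      by (rule commuting_with_nonzero_imp_commute)
    then show ?thesis by simp
  qed
  then have "sum ?w V = ?w u"
    using u V by (subst sum.remove[of V u]) auto
  with symplectic_sum_zero[OF G, of z z'] zz' show False by simp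
qed

theorem theorem2:
  fixes q :: nat
    and V :: "'v set"
    and \<Gamma> :: "'v \<Rightarrow> 'v \<Rightarrow> 'q::prime_card mod_ring"
  assumes "prime q" and "CARD('q) = q"
    and "undirected_simple_multigraph V \<Gamma>"
  shows "(\<exists>\<L>. MLS_cover V \<Gamma> \<L>) \<and> (\<forall>u\<in>V. \<exists>L. minimal_local_set V \<Gamma> L \<and> u \<in> L)"
proof -
  have "\<forall>u\<in>V. \<exists>L. minimal_local_set V \<Gamma> L \<and> u \<in> L"
    using ex_minimal_local_set_containing[OF assms(3)] by blast
  then have "MLS_cover V \<Gamma> {L. minimal_local_set V \<Gamma> L}" by (auto simp: MLS_cover_def)
  with \<open>\<forall>u\<in>V. _\<close> show ?thesis by blast
qed

end
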